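(* Let $k,n$ be positive integers, and put $a=2k$ and $b=a(n+1)-2$. For positive integers $t$, let $C^{(-)}_{t,n}$ denote the number of $(t,\,t(n+1)-1)$-Dyck paths; since $\gcd(t,t(n+1)-1)=1$, this equals $\frac{1}{t(n+2)-1}\binom{t(n+2)-1}{t}$. Then the number $|\mathscr{D}_{a,b}|$ of $(a,b)$-Dyck paths satisfies \[ |\mathscr{D}_{a,b}| = C^{(-)}_{a,n}-\sum_{j=1}^{k-1} C^{(-)}_{a-j,n}\,C^{(-)}_{j,n}. \]
   Context: For positive integers $a,b$, an $(a,b)$-Dyck path is a lattice path from $(0,a)$ to $(b,0)$ using unit steps $(1,0)$ (east) and $(0,-1)$ (south) which never goes strictly above the line segment joining $(0,a)$ to $(b,0)$ (touching the segment is allowed). Equivalently, it is determined by the sequence $(\lambda_{a-1},\dots,\lambda_1)$ of nonnegative integers, weakly increasing from $\lambda_{a-1}$ to $\lambda_1$, with $\lambda_{a-l}\le \lfloor bl/a\rfloor$ for $1\le l\le a-1$ (the numbers of unit boxes to the left of the path in the rows of the $a\times b$ rectangle). $\mathscr{D}_{a,b}$ denotes the set of $(a,b)$-Dyck paths. It is standard that when $\gcd(a,b)=1$, $|\mathscr{D}_{a,b}|=\frac{1}{a+b}\binom{a+b}{a}$. *)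

theory Defs
  imports Complex_Main
begin

datatype step = East | South

fun step_vec :: "step \<Rightarrow> int \<times> int" where
  "step_vec East = (1, 0)"
| "step_vec South = (0, -1)"

definition path_point :: "nat \<Rightarrow> step list \<Rightarrow> nat \<Rightarrow> int \<times> int" where
  "path_point a w i =
     ((\<Sum>s\<leftarrow>take i w. fst (step_vec s)), int a + (\<Sum>s\<leftarrow>take i w. snd (step_vec s)))"

definition strictly_above :: "nat \<Rightarrow> nat \<Rightarrow> int \<times> int \<Rightarrow> bool" where
  "strictly_above a b p \<longleftrightarrow> int a * fst p + int b * snd p > int a * int b"

(* The line through (0, a) and (b, 0) is a x + b y = a b.  It suffices to test the lattice
   points of the path: on each unit step a x + b y is maximal at one of the two endpoints. *)
definition dyck_paths :: "nat \<Rightarrow> nat \<Rightarrow> step list set" where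
  "dyck_paths a b = {w. path_point a w (length w) = (int b, 0) \<and>
     (\<forall>i\<le>length w. \<not> strictly_above a b (path_point a w i))}"

definition C_minus :: "nat \<Rightarrow> nat \<Rightarrow> nat" where
  "C_minus t n = card (dyck_paths t (t * (n + 1) - 1))"

end

theory Submission
  imports Defs
begin

text \<open>
  Put m = n + 1 and let a south step raise the height by m and an east step lower it by 1.
  The (t, tm - 1)-Dyck paths are the words with t south steps and final height 1 all of whose
  nonempty prefixes have height at least 1. Deleting the initial south step and reading such a
  word backwards gives a weak ballot sequence, and these are counted by the ballot recurrence.

  For a = 2k, appending an east step embeds the (a, am - 2)-Dyck paths into the
  (a, am - 1)-Dyck paths. The words missed are those with a proper prefix of height 1 containing
  more than k south steps. Cutting at the longest such prefix, and dropping the final east step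
  of what remains, leaves two words of the same kind, with a - j and j south steps, 0 < j < k.
\<close>

section \<open>Words, heights and the prefix form of the Dyck condition\<close>

definition height :: "nat \<Rightarrow> step list \<Rightarrow> int" where
  "height m w = int m * int (count_list w South) - int (count_list w East)"

lemma height_Nil [simp]: "height m [] = 0"
  by (simp add: height_def)

lemma height_Cons [simp]:
  "height m (s # w) = (case s of South \<Rightarrow> int m | East \<Rightarrow> -1) + height m w"
  by (simp add: height_def algebra_simps split: step.split)

lemma height_append [simp]: "height m (u @ v) = height m u + height m v"
  by (simp add: height_def algebra_simps)

lemma length_eq_count: "length w = count_list w East + count_list w South"
proof (induction w)
  case (Cons s w)
  then show ?case by (cases s) auto
qed simp

lemma finite_words_count: "finite {w. count_list w East = p \<and> count_list w South = q}"
proof (rule finite_subset)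
  show "{w. count_list w East = p \<and> count_list w South = q}
      \<subseteq> {w. set w \<subseteq> {East, South} \<and> length w = p + q}"
    using step.exhaust by (auto simp: length_eq_count)
  show "finite {w. set w \<subseteq> {East, South} \<and> length w = p + q}"
    by (rule finite_lists_length_eq) simp
qed

lemma sum_fst_step_vec: "(\<Sum>s\<leftarrow>w. fst (step_vec s)) = int (count_list w East)"
proof (induction w)
  case (Cons s w)
  then show ?case by (cases s) auto
qed simp

lemma sum_snd_step_vec: "(\<Sum>s\<leftarrow>w. snd (step_vec s)) = - int (count_list w South)"
proof (induction w)
  case (Cons s w)
  then show ?case by (cases s) auto
qed simp

text \<open>Splittings \<open>w = p @ q\<close> replace indices. A prefix with x east and l south
  steps ends at (x, a - l), and a x + b (a - l) <= a b simplifies to a x <= b l.\<close>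

lemma mem_dyck_paths_iff:
  "w \<in> dyck_paths a b \<longleftrightarrow> count_list w East = b \<and> count_list w South = a \<and>
     (\<forall>p q. w = p @ q \<longrightarrow> int a * int (count_list p East) \<le> int b * int (count_list p South))"
proof -
  have all: "(\<forall>i\<le>length w. Q (take i w)) \<longleftrightarrow> (\<forall>p q. w = p @ q \<longrightarrow> Q p)" for Q
    by (metis append_eq_conv_conj append_take_drop_id length_append le_add1)
  have *: "\<not> strictly_above a b (int x, int a + - int l) \<longleftrightarrow> int a * int x \<le> int b * int l" for x l
    by (auto simp: strictly_above_def algebra_simps)
  show ?thesis
    unfolding dyck_paths_def path_point_def sum_fst_step_vec sum_snd_step_vec * mem_Collect_eq
    using all[of "\<lambda>p. int a * int (count_list p East) \<le> int b * int (count_list p South)"]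
    by auto
qed

text \<open>Final height 1 fixes the number of east steps as m t - 1, so only south steps are
  counted explicitly.\<close>

definition pos_words :: "nat \<Rightarrow> nat \<Rightarrow> step list set" where
  "pos_words m t = {w. count_list w South = t \<and> height m w = 1 \<and>
     (\<forall>p q. w = p @ q \<longrightarrow> p \<noteq> [] \<longrightarrow> 1 \<le> height m p)}"

text \<open>A prefix with l south steps and height h has m l - h east steps, so the line condition
  becomes l <= t h. Since l <= t, for l > 0 this means h >= 1.\<close>

lemma dyck_paths_eq_pos_words:
  assumes "m > 0" "t > 0"
  shows "dyck_paths t (t * m - 1) = pos_words m t"
proof -
  have b: "int (t * m - 1) = int t * int m - 1"
    using assms by (simp add: of_nat_diff Suc_leI)
  have main: "int t * int (count_list p East) \<le> int (t * m - 1) * int (count_list p South)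
      \<longleftrightarrow> (p \<noteq> [] \<longrightarrow> 1 \<le> height m p)"
    if "count_list p South \<le> t" for p
  proof (cases "count_list p South = 0")
    \<comment> \<open>Without south steps, both sides say that \<open>p\<close> is empty.\<close>
    case True
    then show ?thesis using assms length_eq_count[of p]
      by (auto simp: height_def mult_le_0_iff)
  next
    case False
    define h where "h = height m p"
    have eq: "int t * int (count_list p East) \<le> int (t * m - 1) * int (count_list p South)
        \<longleftrightarrow> int (count_list p South) \<le> int t * h"
      unfolding b h_def height_def by (simp add: algebra_simps)
    have "int (count_list p South) \<le> int t * h \<longleftrightarrow> 1 \<le> h"
    proof
      assume "int (count_list p South) \<le> int t * h"
      with False have "0 < int t * h" by linarith
      then show "1 \<le> h" by (simp add: zero_less_mult_iff)
    next
      assume "1 \<le> h"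
      then have "int t * 1 \<le> int t * h" by (intro mult_left_mono) auto
      with that show "int (count_list p South) \<le> int t * h" by linarith
    qed
    with eq False show ?thesis by (auto simp: h_def)
  qed
  have cnt: "count_list w East = t * m - 1 \<longleftrightarrow> height m w = 1" if "count_list w South = t" for w
    using that b by (auto simp: height_def algebra_simps)
  have "(\<forall>p q. w = p @ q \<longrightarrow>
        int t * int (count_list p East) \<le> int (t * m - 1) * int (count_list p South))
      \<longleftrightarrow> (\<forall>p q. w = p @ q \<longrightarrow> p \<noteq> [] \<longrightarrow> 1 \<le> height m p)"
    if "count_list w South = t" for w
    using that by (intro iff_allI imp_cong refl main) auto
  with cnt show ?thesis
    unfolding set_eq_iff mem_dyck_paths_iff pos_words_def mem_Collect_eq by blast
qed

lemma finite_pos_words: "finite (pos_words m t)"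
proof (rule finite_subset)
  show "pos_words m t \<subseteq> {w. count_list w East = m * t - 1 \<and> count_list w South = t}"
  proof clarify
    fix w assume "w \<in> pos_words m t"
    then have t: "count_list w South = t" and "height m w = 1"
      by (auto simp: pos_words_def)
    then have "int (Suc (count_list w East)) = int (m * t)"
      by (simp add: height_def)
    then have "Suc (count_list w East) = m * t"
      unfolding of_nat_eq_iff .
    with t show "count_list w East = m * t - 1 \<and> count_list w South = t"
      by simp
  qed
qed (rule finite_words_count)

subsection \<open>Ballot sequences\<close>

text \<open>Votes are counted from the right, so the head of the list is the last vote and recursion
  on the list removes it.\<close>

definition ballot_words :: "nat \<Rightarrow> nat \<Rightarrow> nat \<Rightarrow> step list set" where
  "ballot_words m p q = {w. count_list w East = p \<and> count_list w South = q \<and>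
     (\<forall>u v. w = u @ v \<longrightarrow> m * count_list v South \<le> count_list v East)}"

lemma finite_ballot_words: "finite (ballot_words m p q)"
  by (rule finite_subset[OF _ finite_words_count[of p q]]) (auto simp: ballot_words_def)

lemma ballot_words_empty:
  assumes "p < m * q"
  shows "ballot_words m p q = {}"
proof -
  have "m * q \<le> p" if "w \<in> ballot_words m p q" for w
    using that unfolding ballot_words_def by blast
  with assms show ?thesis by fastforce
qed

lemma ballot_words_0: "ballot_words m p 0 = {replicate p East}"
proof -
  have "w = replicate p East" if "count_list w South = 0" "count_list w East = p" for w
    using that
  proof (induction w arbitrary: p)
    case (Cons s w)
    then show ?case by (cases s) auto
  qed simp
  then have "ballot_words m p 0 \<subseteq> {replicate p East}"
    unfolding ballot_words_def by blast
  moreover have cnt: "count_list (replicate p East) East = p" "count_list (replicate p East) South = 0"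
    by (induction p) auto
  have "count_list v South = 0" if "replicate p East = u @ v" for u v
    using cnt(2) unfolding that by simp
  with cnt have "replicate p East \<in> ballot_words m p 0"
    by (simp add: ballot_words_def)
  ultimately show ?thesis by blast
qed

text \<open>The only suffix of \<open>s # w\<close> that is not a suffix of \<open>w\<close> is the
  whole word, and its condition is m q <= p.\<close>

lemma Cons_mem_ballot_words:
  "s # w \<in> ballot_words m p q \<longleftrightarrow> m * q \<le> p \<and> count_list (s # w) East = p \<and>
     count_list (s # w) South = q \<and> w \<in> ballot_words m (count_list w East) (count_list w South)"
proof -
  have "(\<forall>u v. s # w = u @ v \<longrightarrow> Q v) \<longleftrightarrow> Q (s # w) \<and> (\<forall>u v. w = u @ v \<longrightarrow> Q v)" for Q
    by (auto simp: Cons_eq_append_conv)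
  then show ?thesis
    by (auto simp: ballot_words_def)
qed

text \<open>Case split on the last vote. The hypothesis is the condition on the whole word, which
  membership of the tail in the smaller set does not supply after a south step.\<close>

lemma ballot_words_Suc:
  assumes "m * Suc q \<le> Suc p"
  shows "ballot_words m (Suc p) (Suc q) =
    Cons East ` ballot_words m p (Suc q) \<union> Cons South ` ballot_words m (Suc p) q" (is "?L = ?R")
proof
  have cnt: "count_list w East = p' \<and> count_list w South = q'" if "w \<in> ballot_words m p' q'"
    for w p' q' using that by (auto simp: ballot_words_def)
  show "?L \<subseteq> ?R"
  proof
    fix w assume w: "w \<in> ?L"
    then obtain s v where "w = s # v"
      using cnt[of w] by (cases w) fastforce+
    with w show "w \<in> ?R"
      by (cases s) (auto simp: Cons_mem_ballot_words)
  qed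
  show "?R \<subseteq> ?L"
    using assms cnt by (auto simp: Cons_mem_ballot_words)
qed

text \<open>This is the ballot formula (p + 1 - m q) / (p + 1) * binom(p + q, q) with the
  denominator cleared. The boundary m q = p + 1, where both sides vanish, is included because
  removing an east step when m q = p leads there.\<close>

lemma card_ballot_words:
  assumes "m > 0" "m * q \<le> Suc p"
  shows "real (Suc p) * real (card (ballot_words m p q)) =
    (real (Suc p) - real m * real q) * real ((p + q) choose q)"
  using assms(2)
proof (induction "p + q" arbitrary: p q)
  case 0
  then show ?case by (simp add: ballot_words_0)
next
  case (Suc N p q)
  consider "q = 0" | q' where "q = Suc q'" "p = 0 \<or> m * q = Suc p"
    | p' q' where "q = Suc q'" "p = Suc p'" "m * q \<le> p"
    using Suc.prems by (cases q; cases p) (auto simp: le_Suc_eq)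
  then show ?case
  proof cases
    case 1
    then show ?thesis by (simp add: ballot_words_0)
  next
    case (2 q')
    \<comment> \<open>If p = 0, then q > 0, m > 0 and the bound m q <= 1 force m q = 1.\<close>
    with Suc.prems assms(1) have eq: "m * q = Suc p"
      by (cases m) auto
    then have "ballot_words m p q = {}" "real (Suc p) - real m * real q = 0"
      by (simp_all add: ballot_words_empty flip: of_nat_mult)
    then show ?thesis by simp
  next
    case (3 p' q')
    define A where "A = real ((p' + q) choose q)"
    define B where "B = real ((p + q') choose q')"
    define X where "X = real (card (ballot_words m p' q))"
    define Y where "Y = real (card (ballot_words m p q'))"
    have "card (ballot_words m p q) = card (ballot_words m p' q) + card (ballot_words m p q')"
      using 3(3) unfolding 3(1,2)
      by (subst ballot_words_Suc, simp, subst card_Un_disjoint)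
        (auto simp: finite_ballot_words card_image)
    then have XY: "real (card (ballot_words m p q)) = X + Y"
      by (simp add: X_def Y_def)
    have X: "real p * X = (real p - real m * real q) * A"
      using Suc.hyps(1)[of p' q] Suc.hyps(2) 3 by (simp add: X_def A_def)
    have Y: "real (Suc p) * Y = (real (Suc p) - real m * real q') * B"
      using Suc.hyps(1)[of p q'] Suc.hyps(2) 3 Suc.prems by (simp add: Y_def B_def)
    have AB: "real ((p + q) choose q) = A + B"
      using 3 by (simp add: A_def B_def)
    \<comment> \<open>Both sides are (p + q - 1)! / ((p - 1)! (q - 1)!), since p' = p - 1 and q' = q
      - 1.\<close>
    have "q * ((p' + q) choose q) = p * ((p + q') choose q')"
      using Suc_times_binomial_add[of q' p'] 3(1,2)
      by (simp add: add.commute del: binomial_Suc_Suc)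
    then have "real q * A = real p * B"
      unfolding A_def B_def of_nat_mult[symmetric] by simp
    \<comment> \<open>The induction hypothesis controls X only through p X, hence the factor p,
      which is positive here and cancels at the end. The error term is a multiple of p B - q A,
      which is 0 by the identity just shown.\<close>
    moreover have "real p * (real (Suc p) * (X + Y)) = real p * ((real (Suc p) - real m * real q) * (A + B))
      + real m * (real p * B - real q * A)"
    proof -
      have "real p * (real (Suc p) * (X + Y)) =
          real (Suc p) * (real p * X) + real p * (real (Suc p) * Y)"
        by (simp add: algebra_simps)
      then show ?thesis
        unfolding X Y using 3(1) by (simp add: algebra_simps)
    qed
    ultimately show ?thesis
      unfolding XY AB using 3(2) by simp
  qed
qed

text \<open>Read forwards, a nonempty proper prefix of height at least 1 leaves a suffix of height at
  most 0, which is why \<^const>\<open>ballot_words\<close> is defined by a condition on suffixes.\<close>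

lemma pos_words_eq_Cons_ballot_words:
  assumes "m > 0" "t > 0"
  shows "pos_words m t = Cons South ` ballot_words m (m * t - 1) (t - 1)"
proof (intro equalityI subsetI)
  fix w assume w: "w \<in> pos_words m t"
  then obtain s v where sv: "w = s # v"
    by (cases w) (auto simp: pos_words_def)
  from w have pre: "1 \<le> height m p" if "w = p @ q" "p \<noteq> []" for p q
    using that by (auto simp: pos_words_def)
  \<comment> \<open>An initial east step would be a prefix of height -1.\<close>
  have s: "s = South"
    using pre[of "[s]" v] sv by (cases s) auto
  have 1: "count_list v South = t - 1"
    using w sv s by (auto simp: pos_words_def)
  have "height m w = 1" "count_list w South = t"
    using w by (auto simp: pos_words_def)
  then have "int (Suc (count_list w East)) = int (m * t)"
    by (simp add: height_def)
  then have "Suc (count_list w East) = m * t"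
    unfolding of_nat_eq_iff .
  then have 2: "count_list v East = m * t - 1"
    using sv s by simp
  have "m * count_list y South \<le> count_list y East" if "v = x @ y" for x y
  proof -
    have "height m y = 1 - height m (South # x)"
      using \<open>height m w = 1\<close> sv s that by simp
    also have "\<dots> \<le> 0"
      using pre[of "South # x" y] sv s that by simp
    finally show ?thesis
      by (simp add: height_def flip: of_nat_mult)
  qed
  with 1 2 sv s show "w \<in> Cons South ` ballot_words m (m * t - 1) (t - 1)"
    by (auto simp: ballot_words_def)
next
  fix w assume "w \<in> Cons South ` ballot_words m (m * t - 1) (t - 1)"
  then obtain v where v: "w = South # v" "count_list v South = t - 1" "count_list v East = m * t - 1"
    and suf: "\<And>x y. v = x @ y \<Longrightarrow> m * count_list y South \<le> count_list y East"
    by (auto simp: ballot_words_def)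
  have cnt: "count_list w South = t"
    using v assms by simp
  have "count_list w East = m * t - 1" using v by simp
  moreover have "m * t \<ge> 1" using assms by simp
  ultimately have h: "height m w = 1"
    using cnt by (simp add: height_def of_nat_diff)
  have "1 \<le> height m p" if w: "w = p @ q" and "p \<noteq> []" for p q
  proof -
    from that v obtain x where "p = South # x" "v = x @ q"
      by (auto simp: Cons_eq_append_conv)
    with suf have "height m q \<le> 0"
      by (simp add: height_def flip: of_nat_mult)
    with h w show ?thesis by simp
  qed
  with h cnt show "w \<in> pos_words m t"
    by (auto simp: pos_words_def)
qed

text \<open>The ballot formula with p = m t - 1 and q = t - 1 has p + 1 - m q = m and p + 1 = m t,
  so it gives binom(p + q, t - 1) / t. With N = p + q + 1 = t (m + 1) - 1, absorption turns this
  into binom(N, t) / N.\<close>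

lemma card_pos_words:
  assumes "m > 0" "t > 0"
  shows "real (card (pos_words m t)) =
    1 / real (t * (m + 1) - 1) * real ((t * (m + 1) - 1) choose t)"
proof -
  obtain q where q: "t = Suc q" using assms(2) by (cases t) auto
  define p where "p = m * t - 1"
  have p: "Suc p = m * t" using assms by (simp add: p_def)
  define c where "c = card (pos_words m t)"
  have c: "c = card (ballot_words m p q)"
    unfolding c_def pos_words_eq_Cons_ballot_words[OF assms] using q by (simp add: card_image p_def)
  have N: "t * (m + 1) - 1 = Suc (p + q)"
    using p q by (simp add: algebra_simps)
  have "real (Suc p) - real m * real q = real m"
    unfolding p q by (simp add: algebra_simps)
  moreover have "m * q \<le> Suc p"
    unfolding p q by simp
  ultimately have "real m * (real t * real c) = real m * real ((p + q) choose q)"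
    using card_ballot_words[OF assms(1), of q p] unfolding p c by (simp add: mult.assoc)
  then have "real t * real c = real ((p + q) choose q)"
    using assms by simp
  moreover have "real t * real (Suc (p + q) choose t) = real (Suc (p + q)) * real ((p + q) choose q)"
    using Suc_times_binomial[of q "p + q"] unfolding q of_nat_mult[symmetric] by metis
  ultimately have "real t * real (Suc (p + q) choose t) = real t * (real (Suc (p + q)) * real c)"
    by simp
  then have "real (Suc (p + q) choose t) = real (Suc (p + q)) * real c"
    using assms by simp
  then show ?thesis
    unfolding N c_def[symmetric] by simp
qed

subsection \<open>Cutting at the longest prefix of height 1\<close>

text \<open>For l south steps and height h the line condition becomes l <= k h. As l <= 2 k, height
  1 suffices exactly up to l = k, and height 2 always suffices.\<close>

lemma mem_dyck_paths_minus_2_iff: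
  assumes "m > 1" "k > 0"
  shows "w \<in> dyck_paths (2 * k) (2 * k * m - 2) \<longleftrightarrow> count_list w South = 2 * k \<and> height m w = 2 \<and>
    (\<forall>p q. w = p @ q \<longrightarrow> p \<noteq> [] \<longrightarrow> 1 \<le> height m p \<and> (k < count_list p South \<longrightarrow> 2 \<le> height m p))"
proof -
  \<comment> \<open>This keeps the natural subtraction 2 k m - 2 from truncating.\<close>
  have "2 * 1 \<le> 2 * k * m" using assms by (intro mult_mono) auto
  then have b: "int (2 * k * m - 2) = 2 * int k * int m - 2"
    by (simp add: of_nat_diff)
  have main: "int (2 * k) * int (count_list p East) \<le> int (2 * k * m - 2) * int (count_list p South)
      \<longleftrightarrow> (p \<noteq> [] \<longrightarrow> 1 \<le> height m p \<and> (k < count_list p South \<longrightarrow> 2 \<le> height m p))"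
    if "count_list p South \<le> 2 * k" for p
  proof (cases "count_list p South = 0")
    case True
    then show ?thesis using assms length_eq_count[of p]
      by (auto simp: height_def mult_le_0_iff)
  next
    case False
    define h where "h = height m p"
    define l where "l = count_list p South"
    have eq: "int (2 * k) * int (count_list p East) \<le> int (2 * k * m - 2) * int l
        \<longleftrightarrow> int l \<le> int k * h"
      unfolding b h_def height_def l_def by (auto simp: algebra_simps)
    have "int l \<le> int k * h \<longleftrightarrow> 1 \<le> h \<and> (k < l \<longrightarrow> 2 \<le> h)"
    proof
      assume *: "int l \<le> int k * h"
      with False have "0 < int k * h" unfolding l_def by linarith
      then have "1 \<le> h" by (simp add: zero_less_mult_iff)
      moreover have "h \<noteq> 1" if "k < l" using * that by auto
      ultimately show "1 \<le> h \<and> (k < l \<longrightarrow> 2 \<le> h)" by fastforce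
    next
      assume *: "1 \<le> h \<and> (k < l \<longrightarrow> 2 \<le> h)"
      show "int l \<le> int k * h"
      proof (cases "k < l")
        case True
        with * have "int k * 2 \<le> int k * h" by (intro mult_left_mono) auto
        with that show ?thesis unfolding l_def by linarith
      next
        case False
        from * have "int k * 1 \<le> int k * h" by (intro mult_left_mono) auto
        with False show ?thesis by linarith
      qed
    qed
    with eq False show ?thesis by (auto simp: h_def l_def)
  qed
  have cnt: "count_list w East = 2 * k * m - 2 \<longleftrightarrow> height m w = 2" if "count_list w South = 2 * k"
    using that b by (auto simp: height_def algebra_simps)
  have "(\<forall>p q. w = p @ q \<longrightarrow>
        int (2 * k) * int (count_list p East) \<le> int (2 * k * m - 2) * int (count_list p South))
      \<longleftrightarrow> (\<forall>p q. w = p @ q \<longrightarrow> p \<noteq> [] \<longrightarrow>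
        1 \<le> height m p \<and> (k < count_list p South \<longrightarrow> 2 \<le> height m p))"
    if "count_list w South = 2 * k"
    using that by (intro iff_allI imp_cong refl main) auto
  with cnt show ?thesis
    unfolding mem_dyck_paths_iff by blast
qed

text \<open>A final south step would start from height 1 - m, which is negative for m > 1; neither
  the empty prefix nor a nonempty one has such a height.\<close>

lemma pos_words_snoc:
  assumes "m > 1" "w \<in> pos_words m t"
  obtains v where "w = v @ [East]"
proof (cases w rule: rev_cases)
  case Nil
  with assms show ?thesis by (auto simp: pos_words_def)
next
  case (snoc v s)
  have "height m w = 1" and "v \<noteq> [] \<Longrightarrow> 1 \<le> height m v"
    using assms snoc by (auto simp: pos_words_def)
  with snoc assms(1) have "s = East"
    by (cases s; cases "v = []") auto
  with snoc that show ?thesis by simp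
qed

text \<open>The extra east step lowers the final height from 2 to 1 and leaves the earlier prefixes
  alone. The case \<open>q = []\<close> is exempt because the whole word has height 1 and 2 k > k
  south steps.\<close>

lemma dyck_paths_minus_2_snoc:
  assumes "m > 1" "k > 0"
  shows "(\<lambda>w. w @ [East]) ` dyck_paths (2 * k) (2 * k * m - 2) =
    {w \<in> pos_words m (2 * k). \<forall>p q. w = p @ q \<longrightarrow> q \<noteq> [] \<longrightarrow> k < count_list p South \<longrightarrow> height m p \<noteq> 1}"
    (is "?L = ?R")
proof (intro equalityI subsetI)
  fix w assume "w \<in> ?L"
  then obtain v where v: "w = v @ [East]" "count_list v South = 2 * k" "height m v = 2"
    and pre: "\<And>p q. v = p @ q \<Longrightarrow> p \<noteq> [] \<Longrightarrow>
      1 \<le> height m p \<and> (k < count_list p South \<longrightarrow> 2 \<le> height m p)"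
    unfolding image_iff Bex_def mem_dyck_paths_minus_2_iff[OF assms] by blast
  have split: "q = [] \<and> p = w \<or> (\<exists>q'. v = p @ q')" if "w = p @ q" for p q
    using that v(1) by (cases q rule: rev_cases) auto
  have "1 \<le> height m p" if "w = p @ q" "p \<noteq> []" for p q
    using split[OF that(1)] pre that(2) v by auto
  moreover have "height m p \<noteq> 1" if "w = p @ q" "q \<noteq> []" "k < count_list p South" for p q
    using split[OF that(1)] pre[of p] that(2,3) by fastforce
  ultimately show "w \<in> ?R"
    using v by (auto simp: pos_words_def)
next
  fix w assume w: "w \<in> ?R"
  then have "w \<in> pos_words m (2 * k)" by simp
  then obtain v where v: "w = v @ [East]"
    by (rule pos_words_snoc[OF assms(1)])
  have "1 \<le> height m p \<and> (k < count_list p South \<longrightarrow> 2 \<le> height m p)" if "v = p @ q" "p \<noteq> []" for p q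
  proof -
    have "w = p @ (q @ [East])" using v that by simp
    with w that(2) have "1 \<le> height m p" "k < count_list p South \<longrightarrow> height m p \<noteq> 1"
      unfolding pos_words_def by blast+
    then show ?thesis by linarith
  qed
  moreover have "count_list v South = 2 * k" "height m v = 2"
    using w v by (auto simp: pos_words_def)
  ultimately have "v \<in> dyck_paths (2 * k) (2 * k * m - 2)"
    unfolding mem_dyck_paths_minus_2_iff[OF assms] by blast
  with v show "w \<in> ?L" by blast
qed

text \<open>As \<open>u\<close> and \<open>u'\<close> both have height 1, the surplus
  \<open>z\<close> of the longer one has height 0. It is a prefix of \<open>v\<close> or
  \<open>v'\<close>, whose nonempty prefixes have height at least 1, so it is empty.\<close>

lemma pos_words_append_inj:
  assumes "u \<in> pos_words m i" "v \<in> pos_words m j" "u' \<in> pos_words m i'" "v' \<in> pos_words m j'"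
    and "u @ v = u' @ v'"
  shows "u = u' \<and> v = v'"
proof -
  have h: "height m u = 1" "height m u' = 1"
    using assms by (auto simp: pos_words_def)
  from assms(5) obtain z where "u = u' @ z \<and> z @ v = v' \<or> u @ z = u' \<and> v = z @ v'"
    by (auto simp: append_eq_append_conv2)
  then show ?thesis
  proof
    assume *: "u = u' @ z \<and> z @ v = v'"
    with h have "height m z = 0" by auto
    with * assms(4) have "z = []" unfolding pos_words_def by fastforce
    with * show ?thesis by simp
  next
    assume *: "u @ z = u' \<and> v = z @ v'"
    with h have "height m z = 0" by auto
    with * assms(2) have "z = []" unfolding pos_words_def by fastforce
    with * show ?thesis by simp
  qed
qed

text \<open>The last east step brings the total height 1 + 1 back to 1.\<close>

lemma pos_words_append:
  assumes "u \<in> pos_words m i" "v \<in> pos_words m j"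
  shows "u @ v @ [East] \<in> pos_words m (i + j)"
proof -
  have "1 \<le> height m p" if "u @ v @ [East] = p @ q" "p \<noteq> []" for p q
  proof -
    from that(1) consider q' where "u = p @ q'" | z where "p = u @ z" "v @ [East] = z @ q"
      by (auto simp: append_eq_append_conv2)
    then show ?thesis
    proof cases
      case 1
      with assms that show ?thesis by (auto simp: pos_words_def)
    next
      case (2 z)
      \<comment> \<open>Here \<open>z\<close> is a prefix of \<open>v @ [East]\<close>: the whole of
        it has height 0, and every other prefix is a prefix of \<open>v\<close>.\<close>
      have "0 \<le> height m z"
      proof (cases q rule: rev_cases)
        case Nil
        with 2 assms show ?thesis by (auto simp: pos_words_def simp flip: 2(2))
      next
        case (snoc q' s)
        with 2 have "v = z @ q'" by simp
        with assms(2) have "z \<noteq> [] \<longrightarrow> 1 \<le> height m z" by (auto simp: pos_words_def)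
        then show ?thesis by (cases "z = []") auto
      qed
      with 2 assms show ?thesis by (auto simp: pos_words_def)
    qed
  qed
  with assms show ?thesis by (auto simp: pos_words_def)
qed

text \<open>The range of j reflects the cut: the first part has 2 k - j south steps, more than k
  exactly when j < k, and a second part of height 1 contains at least one.\<close>

lemma pos_words_cut:
  assumes "m > 1" "k > 0"
  shows "{w \<in> pos_words m (2 * k). \<exists>p q. w = p @ q \<and> q \<noteq> [] \<and> k < count_list p South \<and> height m p = 1}
    = (\<lambda>(j, u, v). u @ v @ [East]) `
        (SIGMA j:{1..k - 1}. pos_words m (2 * k - j) \<times> pos_words m j)" (is "?L = ?R")
proof (intro equalityI subsetI)
  fix w assume "w \<in> ?R"
  then obtain j u v where j: "1 \<le> j" "j \<le> k - 1" and uv: "u \<in> pos_words m (2 * k - j)"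
    "v \<in> pos_words m j" and w: "w = u @ v @ [East]"
    by auto
  have "w \<in> pos_words m (2 * k)"
    using pos_words_append[OF uv] j w by simp
  moreover have "k < count_list u South" "height m u = 1"
    using uv j by (auto simp: pos_words_def)
  ultimately show "w \<in> ?L" using w by blast
next
  fix w assume wL: "w \<in> ?L"
  then have w: "w \<in> pos_words m (2 * k)" by simp
  from w have pre: "1 \<le> height m p" if "w = p @ q" "p \<noteq> []" for p q
    using that by (auto simp: pos_words_def)
  define Q where "Q p \<longleftrightarrow> (\<exists>q. w = p @ q \<and> q \<noteq> [] \<and> k < count_list p South \<and> height m p = 1)" for p
  have "\<exists>p. Q p" using wL by (auto simp: Q_def)
  moreover have "\<forall>p. Q p \<longrightarrow> length p < Suc (length w)" by (auto simp: Q_def)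
  ultimately obtain u where u: "Q u" and max: "\<And>p. Q p \<Longrightarrow> length p \<le> length u"
    using ex_has_greatest_nat[of Q _ length "Suc (length w)"] by blast
  from u obtain q where q: "w = u @ q" "q \<noteq> []" "k < count_list u South" "height m u = 1"
    by (auto simp: Q_def)
  obtain w' where "w = w' @ [East]" by (rule pos_words_snoc[OF assms(1) w])
  with q obtain v where v: "q = v @ [East]"
    by (cases q rule: rev_cases) auto
  define j where "j = count_list v South"
  have "height m w = 1" "count_list w South = 2 * k" using w by (auto simp: pos_words_def)
  then have hv: "height m v = 1" and cu: "count_list u South + j = 2 * k"
    using q v by (auto simp: j_def)
  have "j > 0" using hv by (auto simp: height_def j_def intro!: Nat.gr0I)
  have "1 \<le> height m z" if "v = z @ y" "z \<noteq> []" for z y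
  proof -
    have *: "w = (u @ z) @ (y @ [East])" using q v that by simp
    \<comment> \<open>The longer proper prefix \<open>u @ z\<close> also has more than k south
      steps, so by maximality of \<open>u\<close> its height is not 1. It is therefore at least 2,
      and removing \<open>u\<close> leaves at least 1 for \<open>z\<close>.\<close>
    have "\<not> Q (u @ z)" using max[of "u @ z"] that by auto
    with * q(3) have "height m (u @ z) \<noteq> 1" unfolding Q_def by fastforce
    with pre[OF *] that q(4) show ?thesis by simp
  qed
  with hv have "v \<in> pos_words m j" by (auto simp: pos_words_def j_def)
  moreover have "u \<in> pos_words m (2 * k - j)"
    using pre q cu by (auto simp: pos_words_def)
  moreover have "j \<in> {1..k - 1}" using \<open>j > 0\<close> cu q(3) by auto
  ultimately show "w \<in> ?R" using q(1) v by force
qed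

lemma card_pos_words_split:
  assumes "m > 1" "k > 0"
  shows "card (pos_words m (2 * k)) = card (dyck_paths (2 * k) (2 * k * m - 2)) +
    (\<Sum>j = 1..k - 1. card (pos_words m (2 * k - j)) * card (pos_words m j))"
proof -
  let ?S = "SIGMA j:{1..k - 1}. pos_words m (2 * k - j) \<times> pos_words m j"
  let ?f = "\<lambda>(j, u, v). u @ v @ [East]"
  let ?A = "(\<lambda>w. w @ [East]) ` dyck_paths (2 * k) (2 * k * m - 2)"
  \<comment> \<open>The two sets are cut out of \<open>pos_words m (2 * k)\<close> by opposite
    conditions on proper prefixes.\<close>
  have un: "pos_words m (2 * k) = ?A \<union> ?f ` ?S" and disj: "?A \<inter> ?f ` ?S = {}"
    unfolding dyck_paths_minus_2_snoc[OF assms] pos_words_cut[OF assms, symmetric] by blast+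
  have "inj_on ?f ?S"
  proof (rule inj_onI, clarify)
    fix j u v j' u' v'
    assume *: "u \<in> pos_words m (2 * k - j)" "v \<in> pos_words m j"
      "u' \<in> pos_words m (2 * k - j')" "v' \<in> pos_words m j'" "u @ v @ [East] = u' @ v' @ [East]"
    then have "u = u' \<and> v = v'" by (intro pos_words_append_inj[OF *(1-4)]) auto
    \<comment> \<open>The index j is recovered as the number of south steps in
      \<open>v\<close>.\<close>
    with * show "j = j' \<and> (u, v) = (u', v')" by (auto simp: pos_words_def)
  qed
  then have "card (?f ` ?S) = (\<Sum>j = 1..k - 1. card (pos_words m (2 * k - j)) * card (pos_words m j))"
    by (simp add: card_image card_cartesian_product finite_pos_words)
  moreover have "card ?A = card (dyck_paths (2 * k) (2 * k * m - 2))"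
    by (simp add: card_image inj_on_def)
  moreover have "finite ?A" "finite (?f ` ?S)"
    using finite_pos_words[of m "2 * k"] unfolding un by (auto simp only: finite_Un)
  ultimately show ?thesis
    using card_Un_disjoint[OF _ _ disj] un by simp
qed

theorem theorem1:
  fixes k n a b :: nat
  assumes "k > 0" and "n > 0"
    and "a = 2 * k" and "b = a * (n + 1) - 2"
  shows "(\<forall>t>0. real (C_minus t n) =
            1 / real (t * (n + 2) - 1) * real ((t * (n + 2) - 1) choose t)) \<and>
         int (card (dyck_paths a b)) =
           int (C_minus a n) - (\<Sum>j = 1..k - 1. int (C_minus (a - j) n) * int (C_minus j n))"
proof
  have C: "C_minus t n = card (pos_words (n + 1) t)" if "t > 0" for t
    using dyck_paths_eq_pos_words[of "n + 1" t] that by (simp add: C_minus_def)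
  show "\<forall>t>0. real (C_minus t n) =
      1 / real (t * (n + 2) - 1) * real ((t * (n + 2) - 1) choose t)"
    using card_pos_words[of "n + 1"] C by (simp add: add.commute)
  \<comment> \<open>All arguments are positive, as \<open>C\<close> demands: j >= 1, and a - j >= k
    + 1 for j <= k - 1.\<close>
  have "(\<Sum>j = 1..k - 1. int (C_minus (a - j) n) * int (C_minus j n)) =
      int (\<Sum>j = 1..k - 1. card (pos_words (n + 1) (2 * k - j)) * card (pos_words (n + 1) j))"
    unfolding of_nat_sum of_nat_mult using C assms by (intro sum.cong) auto
  \<comment> \<open>From \<open>n > 0\<close> comes m = n + 1 > 1, which the splitting requires, and
    b is 2 k m - 2.\<close>
  moreover have "C_minus a n = card (dyck_paths a b) +
      (\<Sum>j = 1..k - 1. card (pos_words (n + 1) (2 * k - j)) * card (pos_words (n + 1) j))"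
    using card_pos_words_split[of "n + 1" k] C[of a] assms by simp
  ultimately show "int (card (dyck_paths a b)) =
      int (C_minus a n) - (\<Sum>j = 1..k - 1. int (C_minus (a - j) n) * int (C_minus j n))"
    by simp
qed

end
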